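(* Let $P_1,\dots,P_N$ be discrete probability measures on $\mathbb{R}^d$ and let $\lambda=(\lambda_1,\dots,\lambda_N)\in\mathbb{R}^N_{>0}$ with $\sum_{i=1}^N\lambda_i=1$. Let $\bar P$ be a ($\lambda$-weighted Wasserstein) barycenter of $P_1,\dots,P_N$ and let $\bar P_{\text{org}}$ be an approximate barycenter in $S_{\text{org}}=\bigcup_{i=1}^N\operatorname{supp}(P_i)$. Then $$\phi(\bar P_{\text{org}})\le 2\cdot\phi(\bar P),$$ and this bound can become tight, i.e., there is a set of measures $P_1,\dots,P_N$ and a set of weights $\lambda_1,\dots,\lambda_N$ for which $\phi(\bar P_{\text{org}})=2\cdot\phi(\bar P)$.
   Context: A discrete probability measure on $\mathbb{R}^d$ is a probability measure with finite support; $\operatorname{supp}(P)$ is its support. $W_2$ is the quadratic Wasserstein distance (with Euclidean ground norm) and $\mathcal P^2(\mathbb{R}^d)$ is the set of probability measures on $\mathbb{R}^d$ with finite second moments. For $P\in\mathcal P^2(\mathbb{R}^d)$ set $\phi(P)=\sum_{i=1}^N\lambda_i W_2(P,P_i)^2$. A barycenter $\bar P$ is a measure in $\mathcal P^2(\mathbb{R}^d)$ with $\phi(\bar P)=\inf_{P\in\mathcal P^2(\mathbb{R}^d)}\phi(P)$. For a finite set $S_0\subset\mathbb{R}^d$, an approximate barycenter in $S_0$ is a probability measure with support contained in $S_0$ that minimizes $\phi$ among all probability measures with support contained in $S_0$. *)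

theory Defs
  imports "HOL-Probability.Probability"
begin

definition borel_prob :: "'a::euclidean_space measure \<Rightarrow> bool" where
  "borel_prob M \<longleftrightarrow> prob_space M \<and> sets M = sets borel"

definition supp :: "'a::euclidean_space measure \<Rightarrow> 'a set" where
  "supp M = {x. \<forall>U. open U \<and> x \<in> U \<longrightarrow> emeasure M U > 0}"

definition discrete_prob :: "'a::euclidean_space measure \<Rightarrow> bool" where
  "discrete_prob M \<longleftrightarrow> borel_prob M \<and> finite (supp M)"

definition P2 :: "'a::euclidean_space measure set" where
  "P2 = {M. borel_prob M \<and> integrable M (\<lambda>x. (norm x)\<^sup>2)}"

definition couplings ::
    "'a::euclidean_space measure \<Rightarrow> 'a measure \<Rightarrow> ('a \<times> 'a) measure set" where
  "couplings P Q = {\<pi>. borel_prob \<pi> \<and> distr \<pi> borel fst = P \<and> distr \<pi> borel snd = Q}"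

(* For measures in P2 the infimum is finite, so enn2real loses nothing there;
   W2 is only meaningful on P2. *)
definition W2 :: "'a::euclidean_space measure \<Rightarrow> 'a measure \<Rightarrow> real" where
  "W2 P Q = sqrt (enn2real (INF \<pi>\<in>couplings P Q.
     \<integral>\<^sup>+ z. ennreal ((dist (fst z) (snd z))\<^sup>2) \<partial>\<pi>))"

definition phi ::
    "nat \<Rightarrow> (nat \<Rightarrow> real) \<Rightarrow> (nat \<Rightarrow> 'a::euclidean_space measure) \<Rightarrow> 'a measure \<Rightarrow> real" where
  "phi N lam P Q = (\<Sum>i=1..N. lam i * (W2 Q (P i))\<^sup>2)"

definition is_barycenter ::
    "nat \<Rightarrow> (nat \<Rightarrow> real) \<Rightarrow> (nat \<Rightarrow> 'a::euclidean_space measure) \<Rightarrow> 'a measure \<Rightarrow> bool" where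
  "is_barycenter N lam P B \<longleftrightarrow> B \<in> P2 \<and> phi N lam P B = (INF Q\<in>P2. phi N lam P Q)"

(* Intended for finite S; a probability measure supported in a finite set is automatically in P2. *)
definition is_approx_barycenter ::
    "nat \<Rightarrow> (nat \<Rightarrow> real) \<Rightarrow> (nat \<Rightarrow> 'a::euclidean_space measure) \<Rightarrow> 'a set \<Rightarrow> 'a measure \<Rightarrow> bool" where
  "is_approx_barycenter N lam P S B \<longleftrightarrow>
     borel_prob B \<and> supp B \<subseteq> S \<and>
     (\<forall>Q. borel_prob Q \<and> supp Q \<subseteq> S \<longrightarrow> phi N lam P B \<le> phi N lam P Q)"

end

(* Glue near-optimal couplings of the barycenter with P_1, ..., P_N along the barycenter, giving
   random vectors Y, X_1, ..., X_N with X_i distributed as P_i. The pointwise inequality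
   sum_ij l_i l_j |X_j - X_i|^2 <= 2 sum_i l_i |Y - X_i|^2 then bounds the l-average of phi(P_j)
   by twice the optimal value; each P_j is admissible for the restricted problem, so the minimizer
   over measures supported in the original support points does at least as well. Two distinct Dirac
   measures with weights 1/2 attain equality. *)
theory Submission
  imports Defs
begin

section \<open>Gluing couplings along a common first marginal\<close>

text \<open>Absolute continuity with respect to the product takes the place of disintegration: each
  \<open>\<pi> i\<close> has a joint density over \<open>Q \<Otimes>\<^sub>M P i\<close>, whose
  sections act as conditional densities given the first coordinate. Multiplying these densities over
  \<open>I\<close> gives the glued measure.\<close>

lemma gluing:
  fixes Q :: "'a measure" and P :: "'i \<Rightarrow> 'b measure" and \<pi> :: "'i \<Rightarrow> ('a \<times> 'b) measure"
  assumes I: "finite I" and Q: "prob_space Q" and P: "\<And>i. i \<in> I \<Longrightarrow> prob_space (P i)"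
    and ac: "\<And>i. i \<in> I \<Longrightarrow> absolutely_continuous (Q \<Otimes>\<^sub>M P i) (\<pi> i)"
    and sets: "\<And>i. i \<in> I \<Longrightarrow> sets (\<pi> i) = sets (Q \<Otimes>\<^sub>M P i)"
    and marginal: "\<And>i. i \<in> I \<Longrightarrow> distr (\<pi> i) Q fst = Q"
  obtains M where "sets M = sets (Q \<Otimes>\<^sub>M Pi\<^sub>M I P)"
    "\<And>i. i \<in> I \<Longrightarrow> distr M (Q \<Otimes>\<^sub>M P i) (\<lambda>w. (fst w, snd w i)) = \<pi> i"
proof -
  \<comment> \<open>The locale \<open>product_sigma_finite\<close> asks for sigma-finiteness at
    every index, but \<open>P\<close> is only controlled on \<open>I\<close>; a trivial sigma-finite
    measure fills the other indices.\<close>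
  define P' where "P' i = (if i \<in> I then P i else count_space {})" for i
  have P'_eq: "P' i = P i" if "i \<in> I" for i
    using that by (simp add: P'_def)
  have PiM_eq: "Pi\<^sub>M I P = Pi\<^sub>M I P'"
    by (rule PiM_cong) (simp_all add: P'_eq)
  interpret Q: prob_space Q by fact
  have sf: "sigma_finite_measure (P' i)" for i
    using P[of i] by (auto simp: P'_def prob_space_def finite_measure_def
        intro: sigma_finite_measure_count_space_finite)
  interpret product_sigma_finite P'
    using sf by (simp add: product_sigma_finite_def)
  interpret PI: sigma_finite_measure "Pi\<^sub>M I P'"
    by (rule sigma_finite[OF I])
  \<comment> \<open>For fixed \<open>y\<close>, the section \<open>f i (y, _)\<close> plays the role
    of the conditional density of the second coordinate with respect to \<open>P' i\<close>.\<close>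
  define f where "f i = RN_deriv (Q \<Otimes>\<^sub>M P' i) (\<pi> i)" for i
  have f_meas [measurable]: "f i \<in> borel_measurable (Q \<Otimes>\<^sub>M P' i)" for i
    by (simp add: f_def)
  have dens: "density (Q \<Otimes>\<^sub>M P' i) (f i) = \<pi> i" if "i \<in> I" for i
  proof -
    interpret pair_sigma_finite Q "P' i"
      by (intro pair_sigma_finite.intro sf Q.sigma_finite_measure_axioms)
    show ?thesis
      unfolding f_def using ac[OF that] sets[OF that]
      by (intro P.density_RN_deriv) (simp_all add: P'_eq that)
  qed
  have int_\<pi>: "(\<integral>\<^sup>+ z. g z \<partial>\<pi> i) = (\<integral>\<^sup>+ y. \<integral>\<^sup>+ x. f i (y, x) * g (y, x) \<partial>P' i \<partial>Q)"
    if [simp]: "i \<in> I" and [measurable]: "g \<in> borel_measurable (Q \<Otimes>\<^sub>M P' i)" for i g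
    unfolding dens[OF \<open>i \<in> I\<close>, symmetric]
    by (simp add: nn_integral_density sigma_finite_measure.nn_integral_fst[OF sf, symmetric])
  \<comment> \<open>The section integral is the density of the first marginal of
    \<open>\<pi> i\<close> with respect to \<open>Q\<close>. That marginal is \<open>Q\<close>
    itself, so uniqueness of densities forces the value 1 almost everywhere.\<close>
  have total: "AE y in Q. (\<integral>\<^sup>+ x. f i (y, x) \<partial>P' i) = 1" if i: "i \<in> I" for i
  proof -
    note sigma_finite_measure.borel_measurable_nn_integral_fst[OF sf, measurable]
    have fst_meas: "fst \<in> measurable (\<pi> i) Q"
      using sets[OF i] by (simp add: measurable_fst cong: measurable_cong_sets)
    show ?thesis
    proof (rule Q.density_unique2)
      fix A assume A[measurable]: "A \<in> sets Q"
      have "(\<integral>\<^sup>+ y. (\<integral>\<^sup>+ x. f i (y, x) \<partial>P' i) * indicator A y \<partial>Q)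
          = (\<integral>\<^sup>+ y. (\<integral>\<^sup>+ x. f i (y, x) * indicator A (fst (y, x)) \<partial>P' i) \<partial>Q)"
        by (intro nn_integral_cong) (simp add: nn_integral_multc)
      also have "\<dots> = (\<integral>\<^sup>+ z. indicator A (fst z) \<partial>\<pi> i)"
        by (subst int_\<pi>[OF i]) simp_all
      also have "\<dots> = (\<integral>\<^sup>+ y. indicator A y \<partial>distr (\<pi> i) Q fst)"
        by (rule nn_integral_distr[symmetric, OF fst_meas]) measurable
      also have "\<dots> = (\<integral>\<^sup>+ y. 1 * indicator A y \<partial>Q)"
        by (simp add: marginal[OF i])
      finally show "(\<integral>\<^sup>+ y. (\<integral>\<^sup>+ x. f i (y, x) \<partial>P' i) * indicator A y \<partial>Q) =
          (\<integral>\<^sup>+ y. 1 * indicator A y \<partial>Q)" .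
    qed measurable
  qed
  (* The coordinates become conditionally independent given the common first component. *)
  define M where "M = density (Q \<Otimes>\<^sub>M Pi\<^sub>M I P') (\<lambda>w. \<Prod>i\<in>I. f i (fst w, snd w i))"
  have proj [measurable]: "(\<lambda>w. (fst w, snd w i)) \<in> measurable (Q \<Otimes>\<^sub>M Pi\<^sub>M I P') (Q \<Otimes>\<^sub>M P' i)"
    if "i \<in> I" for i
    using that by measurable
  have dens_meas [measurable]:
    "(\<lambda>w. \<Prod>i\<in>I. f i (fst w, snd w i)) \<in> borel_measurable (Q \<Otimes>\<^sub>M Pi\<^sub>M I P')"
    by measurable
  have "distr M (Q \<Otimes>\<^sub>M P i) (\<lambda>w. (fst w, snd w i)) = \<pi> i" if i: "i \<in> I" for i
  proof (rule measure_eqI)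
    show "sets (distr M (Q \<Otimes>\<^sub>M P i) (\<lambda>w. (fst w, snd w i))) = sets (\<pi> i)"
      using sets[OF i] by simp
  next
    fix A assume "A \<in> sets (distr M (Q \<Otimes>\<^sub>M P i) (\<lambda>w. (fst w, snd w i)))"
    then have A[measurable]: "A \<in> sets (Q \<Otimes>\<^sub>M P' i)" by (simp add: P'_eq i)
    note proj[OF i, measurable]
    \<comment> \<open>The indicator of \<open>A\<close> is moved into the factor with index
      \<open>i\<close>; the integrand is then a pure product over coordinates and its integral over
      \<open>Pi\<^sub>M I P'\<close> factorizes.\<close>
    define h where "h y k x = f k (y, x) * (if k = i then indicator A (y, x) else 1)" for y k x
    have h_meas: "h y k \<in> borel_measurable (P' k)" if "y \<in> space Q" for y k
      using that unfolding h_def by (cases "k = i") auto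
    have "emeasure (distr M (Q \<Otimes>\<^sub>M P i) (\<lambda>w. (fst w, snd w i))) A
        = (\<integral>\<^sup>+ w. indicator A w \<partial>distr M (Q \<Otimes>\<^sub>M P' i) (\<lambda>w. (fst w, snd w i)))"
      by (simp add: P'_eq i A[unfolded P'_eq[OF i]])
    also have "\<dots> = (\<integral>\<^sup>+ w. indicator A (fst w, snd w i) \<partial>M)"
      by (rule nn_integral_distr) (simp_all add: M_def proj i)
    also have "\<dots> = (\<integral>\<^sup>+ w. (\<Prod>k\<in>I. f k (fst w, snd w k)) * indicator A (fst w, snd w i)
        \<partial>(Q \<Otimes>\<^sub>M Pi\<^sub>M I P'))"
      unfolding M_def by (rule nn_integral_density) measurable
    also have "\<dots> = (\<integral>\<^sup>+ w. (\<Prod>k\<in>I. h (fst w) k (snd w k)) \<partial>(Q \<Otimes>\<^sub>M Pi\<^sub>M I P'))"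
      using I i by (intro nn_integral_cong) (simp add: h_def prod.distrib prod.delta)
    also have "\<dots> = (\<integral>\<^sup>+ y. \<integral>\<^sup>+ x. (\<Prod>k\<in>I. h y k (x k)) \<partial>Pi\<^sub>M I P' \<partial>Q)"
    proof (subst PI.nn_integral_fst[symmetric])
      show "(\<lambda>w. \<Prod>k\<in>I. h (fst w) k (snd w k)) \<in> borel_measurable (Q \<Otimes>\<^sub>M Pi\<^sub>M I P')"
        unfolding h_def using I i by (simp add: prod.distrib prod.delta)
    qed simp
    also have "\<dots> = (\<integral>\<^sup>+ y. (\<Prod>k\<in>I. \<integral>\<^sup>+ x. h y k x \<partial>P' k) \<partial>Q)"
      by (intro nn_integral_cong product_nn_integral_prod I h_meas)
    \<comment> \<open>By \<open>total\<close>, every factor with \<open>k \<noteq> i\<close>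
      integrates to 1 for almost every \<open>y\<close>; finiteness of \<open>I\<close> allows one
      exceptional null set for all \<open>k\<close>.\<close>
    also have "\<dots> = (\<integral>\<^sup>+ y. \<integral>\<^sup>+ x. f i (y, x) * indicator A (y, x) \<partial>P' i \<partial>Q)"
    proof (rule nn_integral_cong_AE)
      have "AE y in Q. \<forall>k\<in>I. (\<integral>\<^sup>+ x. f k (y, x) \<partial>P' k) = 1"
        using I total by (simp add: AE_ball_countable countable_finite)
      then show "AE y in Q. (\<Prod>k\<in>I. \<integral>\<^sup>+ x. h y k x \<partial>P' k)
          = (\<integral>\<^sup>+ x. f i (y, x) * indicator A (y, x) \<partial>P' i)"
        by eventually_elim (use I i in \<open>simp add: prod.remove[of I i] h_def\<close>)
    qed
    also have "\<dots> = (\<integral>\<^sup>+ z. indicator A z \<partial>\<pi> i)"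
      by (rule int_\<pi>[OF i, symmetric]) measurable
    also have "\<dots> = emeasure (\<pi> i) A"
      using A sets[OF i] by (simp add: P'_eq i)
    finally show "emeasure (distr M (Q \<Otimes>\<^sub>M P i) (\<lambda>w. (fst w, snd w i))) A = emeasure (\<pi> i) A" .
  qed
  moreover have "sets M = sets (Q \<Otimes>\<^sub>M Pi\<^sub>M I P)"
    by (simp add: M_def PiM_eq)
  ultimately show thesis by (intro that)
qed

section \<open>Supports, transport costs and couplings with discrete measures\<close>

abbreviation transport_cost :: "('a::euclidean_space \<times> 'a) measure \<Rightarrow> ennreal" where
  "transport_cost \<pi> \<equiv> \<integral>\<^sup>+ z. ennreal ((dist (fst z) (snd z))\<^sup>2) \<partial>\<pi>"

text \<open>The complement of the support is the union of all open null sets; by the Lindelof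
  property countably many of them already cover it, so it is null.\<close>

lemma AE_in_supp:
  fixes M :: "'a::euclidean_space measure"
  assumes "sets M = sets borel"
  shows "AE x in M. x \<in> supp M"
proof -
  define \<F> where "\<F> = {U. open U \<and> emeasure M U = 0}"
  obtain \<F>' where \<F>': "\<F>' \<subseteq> \<F>" "countable \<F>'" "\<Union>\<F>' = \<Union>\<F>"
    using Lindelof[of \<F>] by (auto simp: \<F>_def)
  have "\<Union>\<F>' \<in> null_sets M"
  proof -
    have "U \<in> null_sets M" if "U \<in> \<F>'" for U
      using \<F>'(1) that assms by (auto simp: \<F>_def null_sets_def)
    then show ?thesis
      using null_sets_UN'[OF \<F>'(2), of "\<lambda>U. U" M] by simp
  qed
  moreover have "{x \<in> space M. x \<notin> supp M} \<subseteq> \<Union>\<F>'"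
    by (auto simp: \<F>'(3) supp_def \<F>_def zero_less_iff_neq_zero)
  ultimately show ?thesis by (rule AE_I')
qed

lemma square_W2_eq: "(W2 P Q)\<^sup>2 = enn2real (INF \<pi>\<in>couplings P Q. transport_cost \<pi>)"
  by (simp add: W2_def)

lemma W2_le_transport_cost:
  assumes "\<pi> \<in> couplings P Q"
  shows "ennreal ((W2 P Q)\<^sup>2) \<le> transport_cost \<pi>"
proof -
  \<comment> \<open>This includes \<open>x = \<top>\<close>, where \<open>enn2real\<close> returns
    0, so no finiteness of the infimum is required.\<close>
  have "ennreal (enn2real x) \<le> x" for x
    by (simp add: ennreal_enn2real_if)
  then show ?thesis
    unfolding square_W2_eq by (rule order_trans) (rule INF_lower[OF assms])
qed

text \<open>One coupling of finite cost makes the infimum finite, so \<open>enn2real\<close> loses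
  nothing and the infimum can be approached within \<open>\<epsilon>\<close>. Near-optimal couplings
  avoid the question whether the infimum is attained.\<close>

lemma W2_near_optimal:
  assumes "\<pi>\<^sub>0 \<in> couplings P Q" "transport_cost \<pi>\<^sub>0 < \<infinity>" "\<epsilon> > 0"
  obtains \<pi> where "\<pi> \<in> couplings P Q" "transport_cost \<pi> \<le> ennreal ((W2 P Q)\<^sup>2 + \<epsilon>)"
proof -
  define c where "c = (INF \<pi>\<in>couplings P Q. transport_cost \<pi>)"
  have "c < \<top>"
    using assms by (auto simp: c_def INF_less_iff)
  then have "c = ennreal ((W2 P Q)\<^sup>2)"
    unfolding square_W2_eq c_def by simp
  then have "c < ennreal ((W2 P Q)\<^sup>2 + \<epsilon>)"
    using \<open>\<epsilon> > 0\<close> by (simp add: ennreal_lessI)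
  then show thesis
    unfolding c_def INF_less_iff using that by (auto intro: less_imp_le)
qed

lemma sets_pair_borel:
  fixes P Q :: "'a::euclidean_space measure"
  assumes "sets P = sets borel" "sets Q = sets borel"
  shows "sets (P \<Otimes>\<^sub>M Q) = sets borel"
  unfolding sets_pair_measure_cong[OF assms] borel_prod by (rule refl)

text \<open>Couplings carry the Borel sets of the product type, while the projection rules concern
  the product sigma-algebra; \<open>borel_prod\<close> identifies the two.\<close>

lemma borel_measurable_fst_snd [measurable]:
  "fst \<in> borel_measurable (borel :: ('a::euclidean_space \<times> 'a) measure)"
  "snd \<in> borel_measurable (borel :: ('a::euclidean_space \<times> 'a) measure)"
  unfolding borel_prod[symmetric] by (rule measurable_fst measurable_snd)+

lemma couplings_pair_measure:
  assumes "borel_prob P" "borel_prob Q"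
  shows "P \<Otimes>\<^sub>M Q \<in> couplings P Q"
proof -
  interpret p: prob_space P using assms by (simp add: borel_prob_def)
  interpret q: prob_space Q using assms by (simp add: borel_prob_def)
  interpret pq: pair_prob_space P Q ..
  have s: "sets P = sets borel" "sets Q = sets borel"
    using assms by (simp_all add: borel_prob_def)
  note sets_pair_borel[OF s]
  moreover have "distr (P \<Otimes>\<^sub>M Q) borel fst = P"
  proof -
    have "distr (P \<Otimes>\<^sub>M Q) borel fst = distr (P \<Otimes>\<^sub>M Q) P fst"
      by (rule distr_cong) (simp_all add: s)
    then show ?thesis by (simp add: q.distr_pair_fst q.emeasure_space_1)
  qed
  moreover have "distr (P \<Otimes>\<^sub>M Q) borel snd = Q"
  proof (rule measure_eqI)
    fix A assume "A \<in> sets (distr (P \<Otimes>\<^sub>M Q) borel snd)"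
    then have A: "A \<in> sets Q" by (simp add: s)
    have "snd \<in> measurable (P \<Otimes>\<^sub>M Q) borel"
      using measurable_snd[of P Q] s by (simp cong: measurable_cong_sets)
    moreover have "snd -` A \<inter> space (P \<Otimes>\<^sub>M Q) = space P \<times> A"
      using sets.sets_into_space[OF A] by (auto simp: space_pair_measure)
    moreover have "emeasure (P \<Otimes>\<^sub>M Q) (space P \<times> A) = emeasure Q A"
      using q.emeasure_pair_measure_Times[OF sets.top[of P] A] by (simp add: p.emeasure_space_1)
    ultimately show "emeasure (distr (P \<Otimes>\<^sub>M Q) borel snd) A = emeasure Q A"
      using A by (simp add: emeasure_distr s)
  qed (simp add: s)
  ultimately show ?thesis
    by (simp add: couplings_def borel_prob_def pq.prob_space_axioms)
qed

text \<open>With \<open>supp Q\<close> inside a ball of radius \<open>R\<close>, the squared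
  distance is almost surely at most \<open>2 * (norm y)\<^sup>2 + 2 * R\<^sup>2\<close>, which the
  second moment of \<open>P\<close> makes integrable. The product thus serves as the finite-cost
  coupling that \<open>W2_near_optimal\<close> asks for.\<close>

lemma transport_cost_pair_measure_finite:
  fixes P Q :: "'a::euclidean_space measure"
  assumes P: "P \<in> P2" and Q: "discrete_prob Q"
  shows "transport_cost (P \<Otimes>\<^sub>M Q) < \<infinity>"
proof -
  have bP: "prob_space P" "sets P = sets borel" and int: "integrable P (\<lambda>x. (norm x)\<^sup>2)"
    using P by (simp_all add: P2_def borel_prob_def)
  have bQ: "prob_space Q" "sets Q = sets borel" and fin: "finite (supp Q)"
    using Q by (simp_all add: discrete_prob_def borel_prob_def)
  interpret p: prob_space P by fact
  interpret q: prob_space Q by fact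
  obtain R where R: "\<And>x. x \<in> supp Q \<Longrightarrow> norm x \<le> R"
    using finite_imp_bounded[OF fin] by (auto simp: bounded_iff)
  have meas: "(\<lambda>z. ennreal ((dist (fst z) (snd z))\<^sup>2)) \<in> borel_measurable (P \<Otimes>\<^sub>M Q)"
    unfolding measurable_cong_sets[OF sets_pair_borel[OF bP(2) bQ(2)] refl] by measurable
  have bound: "ennreal ((dist y x)\<^sup>2) \<le> ennreal (2 * (norm y)\<^sup>2 + 2 * R\<^sup>2)" if "x \<in> supp Q" for x y
  proof (rule ennreal_leI)
    have "dist y x \<le> norm y + R"
      using norm_triangle_ineq4[of y x] R[OF that] by (simp add: dist_norm)
    then have "(dist y x)\<^sup>2 \<le> (norm y + R)\<^sup>2"
      by (intro power_mono) simp_all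
    also have "\<dots> \<le> 2 * (norm y)\<^sup>2 + 2 * R\<^sup>2"
      using sum_squares_ge_zero[of "norm y - R" 0] by (simp add: power2_eq_square algebra_simps)
    finally show "(dist y x)\<^sup>2 \<le> 2 * (norm y)\<^sup>2 + 2 * R\<^sup>2" .
  qed
  have "transport_cost (P \<Otimes>\<^sub>M Q) = (\<integral>\<^sup>+ y. \<integral>\<^sup>+ x. ennreal ((dist y x)\<^sup>2) \<partial>Q \<partial>P)"
    by (simp add: q.nn_integral_fst[OF meas, symmetric])
  also have "\<dots> \<le> (\<integral>\<^sup>+ y. \<integral>\<^sup>+ x. ennreal (2 * (norm y)\<^sup>2 + 2 * R\<^sup>2) \<partial>Q \<partial>P)"
  proof (rule nn_integral_mono, rule nn_integral_mono_AE)
    show "AE x in Q. ennreal ((dist y x)\<^sup>2) \<le> ennreal (2 * (norm y)\<^sup>2 + 2 * R\<^sup>2)" for y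
      using AE_in_supp[OF bQ(2)] by eventually_elim (rule bound)
  qed
  also have "\<dots> = (\<integral>\<^sup>+ y. ennreal (2 * (norm y)\<^sup>2 + 2 * R\<^sup>2) \<partial>P)"
    by (simp add: q.emeasure_space_1)
  also have "\<dots> = ennreal (\<integral> y. 2 * (norm y)\<^sup>2 + 2 * R\<^sup>2 \<partial>P)"
    using int by (intro nn_integral_eq_integral) auto
  finally show ?thesis
    by (simp add: le_less_trans[OF _ ennreal_less_top])
qed

text \<open>\<open>Q\<close> lives on finitely many atoms. Over each atom, a null set of the product
  has a \<open>P\<close>-null slice; under \<open>\<pi>\<close> the first coordinate has law
  \<open>P\<close>, so it almost surely misses these finitely many slices. This supplies the
  absolute continuity required by \<open>gluing\<close>.\<close>

lemma coupling_absolutely_continuous: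
  fixes P Q :: "'a::euclidean_space measure"
  assumes P: "borel_prob P" and Q: "discrete_prob Q" and \<pi>: "\<pi> \<in> couplings P Q"
  shows "absolutely_continuous (P \<Otimes>\<^sub>M Q) \<pi>"
  unfolding absolutely_continuous_def
proof
  fix A assume A: "A \<in> null_sets (P \<Otimes>\<^sub>M Q)"
  have sP: "sets P = sets borel" and sQ: "sets Q = sets borel" and fin: "finite (supp Q)"
    and s\<pi>: "sets \<pi> = sets borel" and fst\<pi>: "distr \<pi> borel fst = P" and snd\<pi>: "distr \<pi> borel snd = Q"
    and pP: "prob_space P" and pQ: "prob_space Q"
    using assms by (simp_all add: discrete_prob_def borel_prob_def couplings_def)
  interpret p: prob_space P by fact
  interpret q: prob_space Q by fact
  have A_borel: "A \<in> sets borel" and A_pair: "A \<in> sets (P \<Otimes>\<^sub>M Q)"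
    using A sets_pair_borel[OF sP sQ] by auto
  have [measurable]: "fst \<in> measurable \<pi> borel" "snd \<in> measurable \<pi> borel"
    using s\<pi> by (simp_all add: borel_measurable_fst_snd cong: measurable_cong_sets)
  \<comment> \<open>Positive mass at \<open>x\<close> is what permits cancelling
    \<open>emeasure Q {x}\<close> in \<open>slice\<close>; the support points left out are finitely
    many null singletons.\<close>
  define S where "S = {x \<in> supp Q. emeasure Q {x} > 0}"
  have "AE x in Q. x \<in> S"
  proof -
    have "AE x in Q. \<forall>a\<in>supp Q - S. x \<noteq> a"
      using fin sQ
      by (intro AE_finite_allI AE_I[where N = "{a}" for a]) (auto simp: S_def zero_less_iff_neq_zero)
    with AE_in_supp[OF sQ] show ?thesis by eventually_elim auto
  qed
  have slice: "(\<lambda>y. (y, x)) -` A \<in> null_sets P" if "x \<in> S" for x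
  proof -
    have m: "(\<lambda>y. (y, x)) -` A \<in> sets P"
      using sets_Pair2[OF A_pair] by simp
    \<comment> \<open>The rectangle formed by the slice and \<open>{x}\<close> lies inside the null
      set \<open>A\<close>.\<close>
    have "emeasure P ((\<lambda>y. (y, x)) -` A) * emeasure Q {x} = emeasure (P \<Otimes>\<^sub>M Q) ((\<lambda>y. (y, x)) -` A \<times> {x})"
      using m sQ by (simp add: q.emeasure_pair_measure_Times)
    also have "\<dots> \<le> emeasure (P \<Otimes>\<^sub>M Q) A"
      by (rule emeasure_mono) (use A_pair in auto)
    also have "\<dots> = 0" using A by auto
    finally have "emeasure P ((\<lambda>y. (y, x)) -` A) = 0"
      using that by (auto simp: S_def)
    with m show ?thesis by auto
  qed
  have "AE z in \<pi>. snd z \<in> S"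
  proof -
    have "S \<in> sets borel"
      using fin by (simp add: S_def borel_closed finite_imp_closed)
    then show ?thesis
      using \<open>AE x in Q. x \<in> S\<close> unfolding snd\<pi>[symmetric] by (subst (asm) AE_distr_iff) auto
  qed
  moreover have "AE z in \<pi>. \<forall>x\<in>S. fst z \<notin> (\<lambda>y. (y, x)) -` A"
  proof (rule AE_finite_allI)
    show "finite S" using fin by (simp add: S_def)
    fix x assume x: "x \<in> S"
    have m: "{y. (y, x) \<notin> A} \<in> sets borel"
      using borel_comp[of "(\<lambda>y. (y, x)) -` A"] slice[OF x] sP by (auto simp: vimage_def Compl_eq)
    have "AE y in distr \<pi> borel fst. y \<notin> (\<lambda>y. (y, x)) -` A"
      unfolding fst\<pi> using slice[OF x] by (rule AE_not_in)
    then show "AE z in \<pi>. fst z \<notin> (\<lambda>y. (y, x)) -` A"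
      using m by (subst (asm) AE_distr_iff) auto
  qed
  ultimately have "AE z in \<pi>. z \<notin> A"
    by eventually_elim auto
  then show "A \<in> null_sets \<pi>"
    using A_borel s\<pi> by (simp add: AE_iff_null_sets)
qed

section \<open>The averaged bound on the values of \<open>phi\<close> at the given measures\<close>

text \<open>After translating \<open>y\<close> to the origin and expanding inner products, the left
  side equals \<open>2 * s - 2 * (m \<bullet> m)\<close>, where \<open>m\<close> is the weighted
  mean of the translated points. Only the square of \<open>m\<close> is discarded, so equality holds
  exactly when \<open>y\<close> is the weighted mean of the \<open>x i\<close>.\<close>

lemma weighted_pairwise_dist_le:
  fixes x :: "'i \<Rightarrow> 'a::real_inner"
  assumes "(\<Sum>i\<in>I. l i) = 1"
  shows "(\<Sum>j\<in>I. \<Sum>i\<in>I. l j * l i * (dist (x j) (x i))\<^sup>2) \<le> 2 * (\<Sum>i\<in>I. l i * (dist y (x i))\<^sup>2)"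
proof -
  define u where "u i = x i - y" for i
  define m where "m = (\<Sum>i\<in>I. l i *\<^sub>R u i)"
  define s where "s = (\<Sum>i\<in>I. l i * (u i \<bullet> u i))"
  have d: "(dist (x j) (x i))\<^sup>2 = u j \<bullet> u j + u i \<bullet> u i - 2 * (u j \<bullet> u i)" for i j
    by (simp add: u_def dist_norm power2_norm_eq_inner algebra_simps inner_commute)
  have "(\<Sum>j\<in>I. \<Sum>i\<in>I. l j * l i * (dist (x j) (x i))\<^sup>2)
      = (\<Sum>j\<in>I. \<Sum>i\<in>I. (l j * (u j \<bullet> u j)) * l i + l j * (l i * (u i \<bullet> u i))
          - 2 * ((l j *\<^sub>R u j) \<bullet> (l i *\<^sub>R u i)))"
    by (intro sum.cong refl) (simp add: d algebra_simps)
  also have "\<dots> = s * (\<Sum>i\<in>I. l i) + (\<Sum>i\<in>I. l i) * s - 2 * (m \<bullet> m)"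
  proof -
    have "(\<Sum>j\<in>I. \<Sum>i\<in>I. (l j *\<^sub>R u j) \<bullet> (l i *\<^sub>R u i)) = m \<bullet> m"
      by (subst sum.swap) (simp only: m_def inner_sum_left inner_sum_right)
    then have "(\<Sum>j\<in>I. \<Sum>i\<in>I. 2 * ((l j *\<^sub>R u j) \<bullet> (l i *\<^sub>R u i))) = 2 * (m \<bullet> m)"
      by (simp only: sum_distrib_left[symmetric])
    then show ?thesis
      by (simp only: sum.distrib sum_subtractf sum_product s_def)
  qed
  also have "\<dots> \<le> 2 * s" using assms by simp
  also have "s = (\<Sum>i\<in>I. l i * (dist y (x i))\<^sup>2)"
    by (simp add: s_def u_def dist_norm power2_norm_eq_inner[symmetric] norm_minus_commute)
  finally show ?thesis .
qed

text \<open>Only upper bounds on the distances between the \<open>P j\<close> are needed, so the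
  joint law of \<open>X j\<close> and \<open>X i\<close> under the glued measure suffices as a
  coupling, however far from optimal it is. Optimality of \<open>Q\<close> does not enter: the bound
  compares with every \<open>Q\<close> in \<open>P2\<close>.\<close>

lemma sum_phi_le_twice_phi:
  fixes P :: "nat \<Rightarrow> 'a::euclidean_space measure"
  assumes P: "\<And>i. i \<in> {1..N} \<Longrightarrow> discrete_prob (P i)"
    and lam: "\<And>i. i \<in> {1..N} \<Longrightarrow> lam i \<ge> 0" "(\<Sum>i=1..N. lam i) = 1"
    and Q: "Q \<in> P2"
  shows "(\<Sum>j=1..N. lam j * phi N lam P (P j)) \<le> 2 * phi N lam P Q"
proof (rule field_le_epsilon)
  fix e :: real assume "e > 0"
  have bP: "borel_prob (P i)" if "i \<in> {1..N}" for i
    using P[OF that] by (simp add: discrete_prob_def)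
  have bQ: "borel_prob Q" using Q by (simp add: P2_def)
  have sets: "sets (Q \<Otimes>\<^sub>M P i) = sets borel" if "i \<in> {1..N}" for i
    using bP[OF that] bQ by (simp add: borel_prob_def sets_pair_borel)
  \<comment> \<open>The slack \<open>e / 2\<close> is doubled by the factor 2 of the pointwise
    inequality and averaged with weights of total 1, giving exactly \<open>e\<close> at the
    end.\<close>
  have "\<exists>\<pi>. \<pi> \<in> couplings Q (P i) \<and> transport_cost \<pi> \<le> ennreal ((W2 Q (P i))\<^sup>2 + e / 2)"
    if i: "i \<in> {1..N}" for i
    using W2_near_optimal[OF couplings_pair_measure[OF bQ bP[OF i]]
        transport_cost_pair_measure_finite[OF Q P[OF i]], of "e / 2"] \<open>e > 0\<close> by auto
  then have "\<forall>i\<in>{1..N}. \<exists>\<pi>. \<pi> \<in> couplings Q (P i) \<and>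
      transport_cost \<pi> \<le> ennreal ((W2 Q (P i))\<^sup>2 + e / 2)" by blast
  from bchoice[OF this] obtain \<pi> where \<pi>: "\<And>i. i \<in> {1..N} \<Longrightarrow> \<pi> i \<in> couplings Q (P i)"
    and cost: "\<And>i. i \<in> {1..N} \<Longrightarrow> transport_cost (\<pi> i) \<le> ennreal ((W2 Q (P i))\<^sup>2 + e / 2)"
    by blast
  have marginal: "distr (\<pi> i) Q fst = Q" if "i \<in> {1..N}" for i
  proof -
    have "distr (\<pi> i) Q fst = distr (\<pi> i) borel fst"
      by (rule distr_cong) (use bQ in \<open>simp_all add: borel_prob_def\<close>)
    then show ?thesis using \<pi>[OF that] by (simp add: couplings_def)
  qed
  obtain M where sets_M: "sets M = sets (Q \<Otimes>\<^sub>M Pi\<^sub>M {1..N} P)"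
    and M: "\<And>i. i \<in> {1..N} \<Longrightarrow> distr M (Q \<Otimes>\<^sub>M P i) (\<lambda>w. (fst w, snd w i)) = \<pi> i"
    by (rule gluing[of "{1..N}" Q P \<pi>])
      (use \<pi> bP bQ sets P in \<open>auto simp: couplings_def borel_prob_def marginal
          intro: coupling_absolutely_continuous[unfolded borel_prob_def]\<close>)
  define Y where "Y w = fst w" for w :: "'a \<times> (nat \<Rightarrow> 'a)"
  \<comment> \<open>The default 0 outside the index range makes \<open>X i\<close> measurable for
    every \<open>i\<close>, so \<open>X_meas\<close> can be used without a side condition.\<close>
  define X where "X i w = (if i \<in> {1..N} then snd w i else 0)" for i and w :: "'a \<times> (nat \<Rightarrow> 'a)"
  have Y_meas [measurable]: "Y \<in> borel_measurable M"
  proof -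
    have "Y \<in> measurable (Q \<Otimes>\<^sub>M Pi\<^sub>M {1..N} P) Q"
      unfolding Y_def by measurable
    then show ?thesis
      using bQ by (simp add: borel_prob_def sets_M cong: measurable_cong_sets)
  qed
  have X_meas [measurable]: "X i \<in> borel_measurable M" for i
  proof (cases "i \<in> {1..N}")
    case True
    have "(\<lambda>w. snd w i) \<in> measurable (Q \<Otimes>\<^sub>M Pi\<^sub>M {1..N} P) (P i)"
      using True by measurable
    then have "(\<lambda>w. snd w i) \<in> borel_measurable M"
      using bP[OF True] by (simp add: borel_prob_def sets_M cong: measurable_cong_sets)
    with True show ?thesis by (simp add: X_def[abs_def])
  next
    case False
    then show ?thesis by (simp only: X_def[abs_def] if_False) measurable
  qed
  have YX: "distr M borel (\<lambda>w. (Y w, X i w)) = \<pi> i" if "i \<in> {1..N}" for i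
    unfolding M[OF that, symmetric] by (rule distr_cong) (use that in \<open>simp_all add: sets[OF that] Y_def X_def\<close>)
  have X_distr: "distr M borel (X i) = P i" if i: "i \<in> {1..N}" for i
  proof -
    have "distr (distr M borel (\<lambda>w. (Y w, X i w))) borel snd = distr M borel (X i)"
      by (subst distr_distr) (auto simp: comp_def)
    then show ?thesis
      using \<pi>[OF i] by (simp add: YX[OF i] couplings_def)
  qed
  have XX: "distr M borel (\<lambda>w. (X j w, X i w)) \<in> couplings (P j) (P i)"
    if i: "i \<in> {1..N}" and j: "j \<in> {1..N}" for i j
  proof -
    \<comment> \<open>Total mass 1 is read off from the image of \<open>M\<close> under
      \<open>X i\<close>, which is the probability measure \<open>P i\<close>.\<close>
    have "prob_space M"
      using bP[OF i] X_distr[OF i] prob_space_distrD[OF X_meas[of i]]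
      by (simp add: borel_prob_def)
    then have "prob_space (distr M borel (\<lambda>w. (X j w, X i w)))"
      by (rule prob_space.prob_space_distr) measurable
    then show ?thesis
      using X_distr[OF i] X_distr[OF j]
      by (simp add: couplings_def borel_prob_def distr_distr comp_def)
  qed
  have W_XX: "ennreal ((W2 (P j) (P i))\<^sup>2) \<le> (\<integral>\<^sup>+ w. ennreal ((dist (X j w) (X i w))\<^sup>2) \<partial>M)"
    if i: "i \<in> {1..N}" and j: "j \<in> {1..N}" for i j
    using W2_le_transport_cost[OF XX[OF i j]] by (simp add: nn_integral_distr)
  have W_YX: "(\<integral>\<^sup>+ w. ennreal ((dist (Y w) (X i w))\<^sup>2) \<partial>M) \<le> ennreal ((W2 Q (P i))\<^sup>2 + e / 2)"
    if i: "i \<in> {1..N}" for i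
    using cost[OF i] unfolding YX[OF i, symmetric] by (simp add: nn_integral_distr)
  have lam2: "lam j * lam i \<ge> 0" if "i \<in> {1..N}" "j \<in> {1..N}" for i j
    using lam(1) that by simp
  \<comment> \<open>The estimate runs in \<open>ennreal\<close>, where integrals commute with finite
    weighted sums without integrability conditions; this identity and the next one translate to and
    from real sums.\<close>
  have ennreal_sum: "(\<Sum>i=1..N. ennreal (2 * lam i) * ennreal (g i)) = ennreal (\<Sum>i=1..N. 2 * lam i * g i)"
    if "\<And>i. g i \<ge> 0" for g
  proof -
    have "(\<Sum>i=1..N. ennreal (2 * lam i) * ennreal (g i)) = (\<Sum>i=1..N. ennreal (2 * lam i * g i))"
      using lam(1) that by (intro sum.cong refl ennreal_mult[symmetric]) simp_all
    also have "\<dots> = ennreal (\<Sum>i=1..N. 2 * lam i * g i)"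
      using lam(1) that by (intro sum_ennreal) simp
    finally show ?thesis .
  qed
  have ennreal_sum2: "(\<Sum>j=1..N. \<Sum>i=1..N. ennreal (lam j * lam i) * ennreal (g j i))
      = ennreal (\<Sum>j=1..N. \<Sum>i=1..N. lam j * lam i * g j i)"
    if g: "\<And>i j. g j i \<ge> 0" for g
  proof -
    have "(\<Sum>j=1..N. \<Sum>i=1..N. ennreal (lam j * lam i) * ennreal (g j i))
        = (\<Sum>j=1..N. \<Sum>i=1..N. ennreal (lam j * lam i * g j i))"
      by (intro sum.cong refl ennreal_mult[symmetric] lam2 g)
    also have "\<dots> = (\<Sum>j=1..N. ennreal (\<Sum>i=1..N. lam j * lam i * g j i))"
      by (intro sum.cong refl sum_ennreal mult_nonneg_nonneg lam2 g)
    also have "\<dots> = ennreal (\<Sum>j=1..N. \<Sum>i=1..N. lam j * lam i * g j i)"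
      by (intro sum_ennreal sum_nonneg mult_nonneg_nonneg lam2 g)
    finally show ?thesis .
  qed
  have "ennreal (\<Sum>j=1..N. lam j * phi N lam P (P j))
      = (\<Sum>j=1..N. \<Sum>i=1..N. ennreal (lam j * lam i) * ennreal ((W2 (P j) (P i))\<^sup>2))"
    by (subst ennreal_sum2) (simp_all add: phi_def sum_distrib_left mult.assoc)
  also have "\<dots> \<le> (\<Sum>j=1..N. \<Sum>i=1..N. ennreal (lam j * lam i) *
      (\<integral>\<^sup>+ w. ennreal ((dist (X j w) (X i w))\<^sup>2) \<partial>M))"
    by (intro sum_mono mult_left_mono W_XX) simp_all
  also have "\<dots> = (\<integral>\<^sup>+ w. (\<Sum>j=1..N. \<Sum>i=1..N.
      ennreal (lam j * lam i) * ennreal ((dist (X j w) (X i w))\<^sup>2)) \<partial>M)"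
    by (simp add: nn_integral_sum nn_integral_cmult)
  also have "\<dots> = (\<integral>\<^sup>+ w. ennreal (\<Sum>j=1..N. \<Sum>i=1..N.
      lam j * lam i * (dist (X j w) (X i w))\<^sup>2) \<partial>M)"
    by (subst ennreal_sum2) simp_all
  also have "\<dots> \<le> (\<integral>\<^sup>+ w. ennreal (2 * (\<Sum>i=1..N. lam i * (dist (Y w) (X i w))\<^sup>2)) \<partial>M)"
    by (intro nn_integral_mono ennreal_leI weighted_pairwise_dist_le lam(2))
  also have "\<dots> = (\<integral>\<^sup>+ w. (\<Sum>i=1..N. ennreal (2 * lam i) * ennreal ((dist (Y w) (X i w))\<^sup>2)) \<partial>M)"
    by (subst ennreal_sum) (simp_all add: sum_distrib_left mult.assoc)
  also have "\<dots> = (\<Sum>i=1..N. ennreal (2 * lam i) * (\<integral>\<^sup>+ w. ennreal ((dist (Y w) (X i w))\<^sup>2) \<partial>M))"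
    by (simp add: nn_integral_sum nn_integral_cmult)
  also have "\<dots> \<le> (\<Sum>i=1..N. ennreal (2 * lam i) * ennreal ((W2 Q (P i))\<^sup>2 + e / 2))"
    by (intro sum_mono mult_left_mono W_YX) simp_all
  also have "\<dots> = ennreal (\<Sum>i=1..N. 2 * lam i * ((W2 Q (P i))\<^sup>2 + e / 2))"
    using \<open>e > 0\<close> by (intro ennreal_sum) simp
  also have "(\<Sum>i=1..N. 2 * lam i * ((W2 Q (P i))\<^sup>2 + e / 2)) = 2 * phi N lam P Q + (\<Sum>i=1..N. lam i) * e"
    by (simp add: phi_def sum_distrib_left sum_distrib_right sum.distrib[symmetric] algebra_simps)
  finally have *: "ennreal (\<Sum>j=1..N. lam j * phi N lam P (P j)) \<le> ennreal (2 * phi N lam P Q + e)"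
    by (simp only: lam(2) mult_1)
  \<comment> \<open>Returning to the reals through \<open>ennreal_le_iff\<close> requires a
    nonnegative right side.\<close>
  have "phi N lam P Q \<ge> 0"
    unfolding phi_def by (intro sum_nonneg mult_nonneg_nonneg lam(1)) simp_all
  with * show "(\<Sum>j=1..N. lam j * phi N lam P (P j)) \<le> 2 * phi N lam P Q + e"
    using \<open>e > 0\<close> by (subst (asm) ennreal_le_iff) simp_all
qed

section \<open>Dirac measures and the tight example\<close>

lemma supp_return: "supp (return borel a) = {a::'a::euclidean_space}"
proof (intro equalityI subsetI)
  fix x assume x: "x \<in> supp (return borel a)"
  show "x \<in> {a}"
  proof (rule ccontr)
    assume "x \<notin> {a}"
    then have "emeasure (return borel a) (- {a}) > 0"
      using x by (auto simp: supp_def open_Compl)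
    then show False by simp
  qed
qed (auto simp: supp_def)

lemma borel_prob_return: "borel_prob (return borel a)"
  by (simp add: borel_prob_def prob_space_return)

lemma P2_finite_supp:
  fixes Q :: "'a::euclidean_space measure"
  assumes Q: "borel_prob Q" and fin: "finite (supp Q)"
  shows "Q \<in> P2"
proof -
  have sQ: "sets Q = sets borel" and "prob_space Q"
    using Q by (simp_all add: borel_prob_def)
  interpret prob_space Q by fact
  obtain R where R: "\<And>x. x \<in> supp Q \<Longrightarrow> norm x \<le> R"
    using finite_imp_bounded[OF fin] by (auto simp: bounded_iff)
  have "integrable Q (\<lambda>x. (norm x)\<^sup>2)"
  proof (rule integrable_const_bound)
    show "AE x in Q. norm ((norm x)\<^sup>2) \<le> R\<^sup>2"
      using AE_in_supp[OF sQ] by eventually_elim (auto intro!: power_mono R)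
    show "(\<lambda>x. (norm x)\<^sup>2) \<in> borel_measurable Q"
      unfolding measurable_cong_sets[OF sQ refl] by measurable
  qed
  with Q show ?thesis by (simp add: P2_def)
qed

lemma integrable_dist_square:
  fixes Q :: "'a::euclidean_space measure"
  assumes "Q \<in> P2"
  shows "integrable Q (\<lambda>x. (dist x a)\<^sup>2)"
proof -
  have sQ: "sets Q = sets borel" and "prob_space Q" and int: "integrable Q (\<lambda>x. (norm x)\<^sup>2)"
    using assms by (simp_all add: P2_def borel_prob_def)
  interpret prob_space Q by fact
  show ?thesis
  proof (rule Bochner_Integration.integrable_bound)
    show "integrable Q (\<lambda>x. 2 * (norm x)\<^sup>2 + 2 * (norm a)\<^sup>2)"
      using int by simp
    show "(\<lambda>x. (dist x a)\<^sup>2) \<in> borel_measurable Q"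
      unfolding measurable_cong_sets[OF sQ refl] by measurable
    have "(dist x a)\<^sup>2 \<le> 2 * (norm x)\<^sup>2 + 2 * (norm a)\<^sup>2" for x
    proof -
      have "(dist x a)\<^sup>2 \<le> (norm x + norm a)\<^sup>2"
        by (intro power_mono) (simp_all add: dist_norm norm_triangle_ineq4)
      also have "\<dots> \<le> 2 * (norm x)\<^sup>2 + 2 * (norm a)\<^sup>2"
        using sum_squares_ge_zero[of "norm x - norm a" 0]
        by (simp add: power2_eq_square algebra_simps)
      finally show ?thesis .
    qed
    then show "AE x in Q. norm ((dist x a)\<^sup>2) \<le> norm (2 * (norm x)\<^sup>2 + 2 * (norm a)\<^sup>2)"
      by simp
  qed
qed

text \<open>Under any coupling with a Dirac measure the second coordinate is almost surely
  \<open>a\<close>, so all couplings have the same cost and the infimum is over a constant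
  family.\<close>

lemma square_W2_return:
  fixes Q :: "'a::euclidean_space measure"
  assumes Q: "Q \<in> P2"
  shows "(W2 Q (return borel a))\<^sup>2 = (\<integral>x. (dist x a)\<^sup>2 \<partial>Q)"
proof -
  have bQ: "borel_prob Q" using Q by (simp add: P2_def)
  have "transport_cost \<pi> = (\<integral>\<^sup>+ x. ennreal ((dist x a)\<^sup>2) \<partial>Q)"
    if \<pi>: "\<pi> \<in> couplings Q (return borel a)" for \<pi>
  proof -
    have s: "sets \<pi> = sets borel" and f: "distr \<pi> borel fst = Q"
      and g: "distr \<pi> borel snd = return borel a"
      using \<pi> by (simp_all add: couplings_def borel_prob_def)
    have [measurable]: "fst \<in> measurable \<pi> borel" "snd \<in> measurable \<pi> borel"
      unfolding measurable_cong_sets[OF s refl] by measurable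
    have "AE y in distr \<pi> borel snd. y = a"
      unfolding g by (subst AE_return) auto
    then have "AE z in \<pi>. snd z = a"
      by (subst (asm) AE_distr_iff) auto
    then have "transport_cost \<pi> = (\<integral>\<^sup>+ z. ennreal ((dist (fst z) a)\<^sup>2) \<partial>\<pi>)"
      by (intro nn_integral_cong_AE) auto
    also have "\<dots> = (\<integral>\<^sup>+ x. ennreal ((dist x a)\<^sup>2) \<partial>distr \<pi> borel fst)"
      by (simp add: nn_integral_distr)
    finally show ?thesis by (simp add: f)
  qed
  \<comment> \<open>Over an empty set the infimum would be \<open>\<top>\<close> instead of the
    common value.\<close>
  moreover have "couplings Q (return borel a) \<noteq> {}"
    using couplings_pair_measure[OF bQ borel_prob_return] by auto
  ultimately have "(INF \<pi>\<in>couplings Q (return borel a). transport_cost \<pi>)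
      = (\<integral>\<^sup>+ x. ennreal ((dist x a)\<^sup>2) \<partial>Q)"
    by simp
  also have "\<dots> = ennreal (\<integral>x. (dist x a)\<^sup>2 \<partial>Q)"
    by (intro nn_integral_eq_integral integrable_dist_square Q) simp
  finally show ?thesis
    by (simp add: square_W2_eq)
qed

lemma phi_two_diracs:
  fixes a b :: "'a::euclidean_space"
  assumes Q: "Q \<in> P2"
  shows "phi 2 (\<lambda>_. 1 / 2) (\<lambda>i. return borel (if i = 1 then a else b)) Q
    = (\<integral>x. ((dist x a)\<^sup>2 + (dist x b)\<^sup>2) / 2 \<partial>Q)"
proof -
  have "{1..2::nat} = {1, 2}" by auto
  then show ?thesis
    using integrable_dist_square[OF Q] by (simp add: phi_def square_W2_return[OF Q] add_divide_distrib)
qed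

text \<open>For two Dirac measures \<open>phi\<close> integrates the function
  \<open>((dist x a)\<^sup>2 + (dist x b)\<^sup>2) / 2\<close>. Its minimum over the whole space is
  attained at the midpoint, while at both \<open>a\<close> and \<open>b\<close> it takes twice that
  minimum; hence all measures on \<open>{a, b}\<close> tie.\<close>

lemma two_diracs_tight:
  fixes a b :: "'a::euclidean_space"
  defines "P \<equiv> (\<lambda>i::nat. return borel (if i = 1 then a else b))"
  shows "is_barycenter 2 (\<lambda>_. 1 / 2) P (return borel (midpoint a b))"
    and "is_approx_barycenter 2 (\<lambda>_. 1 / 2) P {a, b} (return borel a)"
    and "phi 2 (\<lambda>_. 1 / 2) P (return borel (midpoint a b)) = (dist a b)\<^sup>2 / 4"
    and "phi 2 (\<lambda>_. 1 / 2) P (return borel a) = (dist a b)\<^sup>2 / 2"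
proof -
  let ?phi = "phi 2 (\<lambda>_. 1 / 2) P"
  have phi: "?phi Q = (\<integral>x. ((dist x a)\<^sup>2 + (dist x b)\<^sup>2) / 2 \<partial>Q)" if "Q \<in> P2" for Q
    using phi_two_diracs[OF that] by (simp add: P_def)
  have dirac: "return borel x \<in> P2" for x :: 'a
    by (rule P2_finite_supp) (simp_all add: borel_prob_return supp_return)
  have phi_dirac: "?phi (return borel x) = ((dist x a)\<^sup>2 + (dist x b)\<^sup>2) / 2" for x
    unfolding phi[OF dirac] by (rule integral_return) simp_all
  show mid: "?phi (return borel (midpoint a b)) = (dist a b)\<^sup>2 / 4"
    unfolding phi_dirac dist_midpoint by (simp add: power_divide)
  show left: "?phi (return borel a) = (dist a b)\<^sup>2 / 2"
    by (simp add: phi_dirac)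
  \<comment> \<open>The triangle inequality followed by
    \<open>(s + t)\<^sup>2 \<le> 2 * (s\<^sup>2 + t\<^sup>2)\<close>, the latter from the square of
    \<open>s - t\<close> being nonnegative.\<close>
  have parallelogram: "(dist a b)\<^sup>2 / 4 \<le> ((dist x a)\<^sup>2 + (dist x b)\<^sup>2) / 2" for x
  proof -
    have "(dist a b)\<^sup>2 \<le> (dist x a + dist x b)\<^sup>2"
      by (intro power_mono dist_triangle3) simp
    also have "\<dots> \<le> 2 * ((dist x a)\<^sup>2 + (dist x b)\<^sup>2)"
      using sum_squares_ge_zero[of "dist x a - dist x b" 0]
      by (simp add: power2_eq_square algebra_simps)
    finally show ?thesis by simp
  qed
  have lower: "(dist a b)\<^sup>2 / 4 \<le> ?phi Q" if Q: "Q \<in> P2" for Q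
  proof -
    interpret prob_space Q using Q by (simp add: P2_def borel_prob_def)
    show ?thesis
      unfolding phi[OF Q] using integrable_dist_square[OF Q] parallelogram
      by (intro integral_ge_const) auto
  qed
  show "is_barycenter 2 (\<lambda>_. 1 / 2) P (return borel (midpoint a b))"
    unfolding is_barycenter_def mid
    by (intro conjI dirac cInf_eq_minimum[symmetric]) (use mid[symmetric] dirac lower in auto)
  have "?phi Q = (dist a b)\<^sup>2 / 2" if Q: "borel_prob Q" "supp Q \<subseteq> {a, b}" for Q
  proof -
    have sQ: "sets Q = sets borel" and "prob_space Q"
      using Q by (simp_all add: borel_prob_def)
    interpret prob_space Q by fact
    have "Q \<in> P2"
      using Q finite_subset[OF Q(2)] by (intro P2_finite_supp) simp_all
    then have "?phi Q = (\<integral>x. ((dist x a)\<^sup>2 + (dist x b)\<^sup>2) / 2 \<partial>Q)" by (rule phi)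
    also have "\<dots> = (\<integral>x. (dist a b)\<^sup>2 / 2 \<partial>Q)"
    proof (rule integral_cong_AE)
      show "AE x in Q. ((dist x a)\<^sup>2 + (dist x b)\<^sup>2) / 2 = (dist a b)\<^sup>2 / 2"
        using AE_in_supp[OF sQ] by eventually_elim (use Q(2) in \<open>auto simp: dist_commute\<close>)
      show "(\<lambda>x. ((dist x a)\<^sup>2 + (dist x b)\<^sup>2) / 2) \<in> borel_measurable Q"
        unfolding measurable_cong_sets[OF sQ refl] by measurable
    qed simp
    finally show ?thesis by (simp add: prob_space)
  qed
  then show "is_approx_barycenter 2 (\<lambda>_. 1 / 2) P {a, b} (return borel a)"
    unfolding is_approx_barycenter_def left by (simp add: borel_prob_return supp_return)
qed

section \<open>The factor 2 bound and its sharpness\<close>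

text \<open>In the existential half, positivity of \<open>phi\<close> at \<open>Pbar\<close> rules
  out the degenerate equality in which both sides are 0, as happens when all the measures
  coincide.\<close>

theorem theorem1:
  shows "(\<forall>(N::nat) (lam::nat \<Rightarrow> real) (P::nat \<Rightarrow> (real ^ 'n) measure) Pbar Porg.
            (\<forall>i\<in>{1..N}. discrete_prob (P i)) \<and>
            (\<forall>i\<in>{1..N}. lam i > 0) \<and> (\<Sum>i=1..N. lam i) = 1 \<and>
            is_barycenter N lam P Pbar \<and>
            is_approx_barycenter N lam P (\<Union>i\<in>{1..N}. supp (P i)) Porg
            \<longrightarrow> phi N lam P Porg \<le> 2 * phi N lam P Pbar)
       \<and> (\<exists>(N::nat) (lam::nat \<Rightarrow> real) (P::nat \<Rightarrow> (real ^ 'n) measure) Pbar Porg.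
            (\<forall>i\<in>{1..N}. discrete_prob (P i)) \<and>
            (\<forall>i\<in>{1..N}. lam i > 0) \<and> (\<Sum>i=1..N. lam i) = 1 \<and>
            is_barycenter N lam P Pbar \<and>
            is_approx_barycenter N lam P (\<Union>i\<in>{1..N}. supp (P i)) Porg \<and>
            phi N lam P Pbar > 0 \<and>
            phi N lam P Porg = 2 * phi N lam P Pbar)"
proof (intro conjI allI impI)
  fix N :: nat and lam :: "nat \<Rightarrow> real" and P :: "nat \<Rightarrow> (real ^ 'n) measure" and Pbar Porg
  assume *: "(\<forall>i\<in>{1..N}. discrete_prob (P i)) \<and> (\<forall>i\<in>{1..N}. lam i > 0) \<and> (\<Sum>i=1..N. lam i) = 1 \<and>
    is_barycenter N lam P Pbar \<and> is_approx_barycenter N lam P (\<Union>i\<in>{1..N}. supp (P i)) Porg"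
  have "phi N lam P Porg \<le> phi N lam P (P j)" if "j \<in> {1..N}" for j
  proof -
    have "borel_prob (P j)" "supp (P j) \<subseteq> (\<Union>i\<in>{1..N}. supp (P i))"
      using * that by (auto simp: discrete_prob_def)
    with * show ?thesis by (simp add: is_approx_barycenter_def)
  qed
  then have "(\<Sum>j=1..N. lam j * phi N lam P Porg) \<le> (\<Sum>j=1..N. lam j * phi N lam P (P j))"
    using * by (intro sum_mono mult_left_mono) (auto intro: less_imp_le)
  also have "(\<Sum>j=1..N. lam j * phi N lam P Porg) = phi N lam P Porg"
    using * by (simp add: sum_distrib_right[symmetric])
  also have "(\<Sum>j=1..N. lam j * phi N lam P (P j)) \<le> 2 * phi N lam P Pbar"
    by (rule sum_phi_le_twice_phi) (use * in \<open>auto simp: is_barycenter_def intro: less_imp_le\<close>)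
  finally show "phi N lam P Porg \<le> 2 * phi N lam P Pbar" .
next
  \<comment> \<open>The atoms are the origin and the all-ones vector; they differ in every
    dimension, which makes \<open>phi\<close> positive at the midpoint.\<close>
  define P where "P = (\<lambda>i::nat. return borel (if i = 1 then 0 else 1 :: real ^ 'n))"
  note tight = two_diracs_tight[where a = "0 :: real ^ 'n" and b = 1, folded P_def]
  have supp: "(\<Union>i\<in>{1..2}. supp (P i)) = {0, 1}"
  proof -
    have "{1..2::nat} = {1, 2}" by auto
    then show ?thesis by (simp add: P_def supp_return insert_commute)
  qed
  show "\<exists>(N::nat) (lam::nat \<Rightarrow> real) (P::nat \<Rightarrow> (real ^ 'n) measure) Pbar Porg.
            (\<forall>i\<in>{1..N}. discrete_prob (P i)) \<and>
            (\<forall>i\<in>{1..N}. lam i > 0) \<and> (\<Sum>i=1..N. lam i) = 1 \<and>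
            is_barycenter N lam P Pbar \<and>
            is_approx_barycenter N lam P (\<Union>i\<in>{1..N}. supp (P i)) Porg \<and>
            phi N lam P Pbar > 0 \<and>
            phi N lam P Porg = 2 * phi N lam P Pbar"
  proof (intro exI conjI)
    show "\<forall>i\<in>{1..2}. discrete_prob (P i)"
      by (simp add: P_def discrete_prob_def borel_prob_return supp_return)
    show "is_approx_barycenter 2 (\<lambda>_. 1 / 2) P (\<Union>i\<in>{1..2}. supp (P i)) (return borel 0)"
      unfolding supp by (rule tight)
    show "is_barycenter 2 (\<lambda>_. 1 / 2) P (return borel (midpoint 0 1))"
      by (rule tight)
  qed (simp_all add: tight(3,4))
qed

end
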